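(* Let $\succsim$ be a binary relation on $l_\infty$. Then $\succsim$ satisfies Weak order, Monotonicity, Continuity, ICRP, Convexity, Monotone continuity and IDIS if and only if there exists a grounded and lower semicontinuous function $c:[0,1]\to[0,\infty]$ with $c(1)=\infty$ such that the function $$I(x)=\min_{\delta\in[0,1)}\Big\{(1-\delta)\sum_{t=0}^{\infty}\delta^t x_t+c(\delta)\Big\}\qquad (x\in l_\infty)$$ is a constant equivalent representing $\succsim$ (with the convention $0^0=1$).
   Context: $l_\infty$ is the space of real bounded sequences $x=(x_0,x_1,\dots)$ indexed by $\mathbb N=\{0,1,2,\dots\}$ with the sup norm. For $\theta\in\mathbb R$, $\theta$ also denotes the constant sequence $(\theta,\theta,\dots)$. $x\ge y$ means $x_n\ge y_n$ for all $n$. A constant equivalent representing $\succsim$ is a function $I:l_\infty\to\mathbb R$ with $x\sim I(x)$ for all $x$ and $x\succsim y$ iff $I(x)\ge I(y)$. For $x,y\in l_\infty$, $A\subseteq\mathbb N$, $xAy$ is the sequence equal to $x_n$ for $n\in A$ and $y_n$ for $n\notin A$; $(E_n)\downarrow\emptyset$ means $E_n\supseteq E_{n+1}$ for all $n$ and $\bigcap_n E_n=\emptyset$. A function $c$ is grounded if $\inf c=0$. Axioms: Weak order: $\succsim$ is complete and transitive. Monotonicity: $x\ge y$ implies $x\succsim y$, and $1\succ 0$. Continuity: whenever $x\succsim y\succsim z$, the sets $\{\alpha\in[0,1]:\alpha x+(1-\alpha)z\succsim y\}$ and $\{\alpha\in[0,1]:y\succsim\alpha x+(1-\alpha)z\}$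 are closed. ICRP: $x\succsim y$ implies $x+\theta\succsim y+\theta$ for all $\theta\in\mathbb R$. Convexity: if $x\succsim\theta$ and $y\succsim\theta$ ($\theta\in\mathbb R$), then $\lambda x+(1-\lambda)y\succsim\theta$ for all $\lambda\in[0,1]$. Monotone continuity: if $x\succ\theta$ ($\theta\in\mathbb R$) and $(E_n)\downarrow\emptyset$, then for every $k\in\mathbb R$ there is $n_0$ with $kE_{n_0}x\succ\theta$. IDIS: for all $x,d\in l_\infty$, $x+d\succsim x$ implies $x+(0,d)\succsim x$, where $(0,d)=(0,d_0,d_1,\dots)$. *)

theory Defs
  imports "HOL-Analysis.Analysis"
begin

type_synonym seq = "nat \<Rightarrow> real"
type_synonym prefrel = "seq \<Rightarrow> seq \<Rightarrow> bool"

definition linf :: "seq set" where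
  "linf = {x. bounded (range x)}"

definition cst :: "real \<Rightarrow> seq" where
  "cst \<theta> = (\<lambda>_. \<theta>)"

definition strict :: "prefrel \<Rightarrow> seq \<Rightarrow> seq \<Rightarrow> bool" where
  "strict R x y \<longleftrightarrow> R x y \<and> \<not> R y x"

definition indiff :: "prefrel \<Rightarrow> seq \<Rightarrow> seq \<Rightarrow> bool" where
  "indiff R x y \<longleftrightarrow> R x y \<and> R y x"

definition splice :: "seq \<Rightarrow> nat set \<Rightarrow> seq \<Rightarrow> seq" where
  "splice x A y = (\<lambda>n. if n \<in> A then x n else y n)"

definition shift0 :: "seq \<Rightarrow> seq" where
  "shift0 d = (\<lambda>n. case n of 0 \<Rightarrow> 0 | Suc m \<Rightarrow> d m)"

definition weak_order :: "prefrel \<Rightarrow> bool" where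
  "weak_order R \<longleftrightarrow>
     (\<forall>x\<in>linf. \<forall>y\<in>linf. R x y \<or> R y x) \<and>
     (\<forall>x\<in>linf. \<forall>y\<in>linf. \<forall>z\<in>linf. R x y \<longrightarrow> R y z \<longrightarrow> R x z)"

definition monotonicity :: "prefrel \<Rightarrow> bool" where
  "monotonicity R \<longleftrightarrow>
     (\<forall>x\<in>linf. \<forall>y\<in>linf. (\<forall>n. x n \<ge> y n) \<longrightarrow> R x y) \<and> strict R (cst 1) (cst 0)"

definition continuity :: "prefrel \<Rightarrow> bool" where
  "continuity R \<longleftrightarrow>
     (\<forall>x\<in>linf. \<forall>y\<in>linf. \<forall>z\<in>linf. R x y \<longrightarrow> R y z \<longrightarrow>
        closed {\<alpha>\<in>{0..1}. R (\<lambda>n. \<alpha> * x n + (1 - \<alpha>) * z n) y} \<and>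
        closed {\<alpha>\<in>{0..1}. R y (\<lambda>n. \<alpha> * x n + (1 - \<alpha>) * z n)})"

definition ICRP :: "prefrel \<Rightarrow> bool" where
  "ICRP R \<longleftrightarrow>
     (\<forall>x\<in>linf. \<forall>y\<in>linf. \<forall>\<theta>::real. R x y \<longrightarrow> R (\<lambda>n. x n + \<theta>) (\<lambda>n. y n + \<theta>))"

definition convexity :: "prefrel \<Rightarrow> bool" where
  "convexity R \<longleftrightarrow>
     (\<forall>x\<in>linf. \<forall>y\<in>linf. \<forall>\<theta>::real. R x (cst \<theta>) \<longrightarrow> R y (cst \<theta>) \<longrightarrow>
        (\<forall>l\<in>{0..1}. R (\<lambda>n. l * x n + (1 - l) * y n) (cst \<theta>)))"

definition monotone_continuity :: "prefrel \<Rightarrow> bool" where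
  "monotone_continuity R \<longleftrightarrow>
     (\<forall>x\<in>linf. \<forall>\<theta>::real. \<forall>E :: nat \<Rightarrow> nat set.
        strict R x (cst \<theta>) \<longrightarrow> (\<forall>n. E (Suc n) \<subseteq> E n) \<longrightarrow> (\<Inter>n. E n) = {} \<longrightarrow>
        (\<forall>k::real. \<exists>n0. strict R (splice (cst k) (E n0) x) (cst \<theta>)))"

definition IDIS :: "prefrel \<Rightarrow> bool" where
  "IDIS R \<longleftrightarrow>
     (\<forall>x\<in>linf. \<forall>d\<in>linf. R (\<lambda>n. x n + d n) x \<longrightarrow> R (\<lambda>n. x n + shift0 d n) x)"

definition constant_equivalent :: "prefrel \<Rightarrow> (seq \<Rightarrow> real) \<Rightarrow> bool" where
  "constant_equivalent R I \<longleftrightarrow>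
     (\<forall>x\<in>linf. indiff R x (cst (I x))) \<and>
     (\<forall>x\<in>linf. \<forall>y\<in>linf. R x y \<longleftrightarrow> I x \<ge> I y)"

definition grounded :: "(real \<Rightarrow> ereal) \<Rightarrow> bool" where
  "grounded c \<longleftrightarrow> (INF \<delta>\<in>{0..1}. c \<delta>) = 0"

definition lsc_on :: "real set \<Rightarrow> (real \<Rightarrow> ereal) \<Rightarrow> bool" where
  "lsc_on S c \<longleftrightarrow>
     (\<forall>\<delta>\<in>S. \<forall>a. a < c \<delta> \<longrightarrow> (\<forall>\<^sub>F \<delta>' in at \<delta> within S. a < c \<delta>'))"

text \<open>(1-\<delta>) \<Sum>_t \<delta>^t x_t; note 0^0 = 1 in Isabelle\<close>
definition disc_val :: "real \<Rightarrow> seq \<Rightarrow> real" where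
  "disc_val \<delta> x = (1 - \<delta>) * (\<Sum>t. \<delta> ^ t * x t)"

definition obj :: "(real \<Rightarrow> ereal) \<Rightarrow> real \<Rightarrow> seq \<Rightarrow> ereal" where
  "obj c \<delta> x = ereal (disc_val \<delta> x) + c \<delta>"

end

(* At each x, the directions d along which x can be improved (I (x + e d) >= I x for some e > 0)
   form a convex cone K that contains the nonnegative sequences and, by IDIS, is invariant under
   the right shift. The heart of the proof is that some geometric weight d |-> disc_val delta d with
   delta < 1 is nonnegative on K: it is then a supergradient of I at x, so
   c delta = SUP y. I y - disc_val delta y does the job, the minimum at x being attained at this delta.
   If there were no such delta, then by compactness of [0,1] finitely many finitely supported
   sequences in K, read as polynomials, would have no common point of nonnegativity, and a suitable
   combination of their shifts would be a uniformly negative element of K. Monotone continuity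
   allows passing to finite support, and it excludes delta = 1 (so also c 1 = infinity). *)

theory Submission
  imports Defs
begin

section \<open>Discounted values\<close>

lemma linfI: "(\<And>t. \<bar>x t\<bar> \<le> B) \<Longrightarrow> x \<in> linf"
  unfolding linf_def by (auto simp: bounded_iff)

lemma linfE:
  assumes "x \<in> linf"
  obtains B where "B \<ge> 0" "\<And>t. \<bar>x t\<bar> \<le> B"
proof -
  obtain B where "\<And>t. \<bar>x t\<bar> \<le> B" using assms by (auto simp: linf_def bounded_iff)
  then show thesis using that[of B] order_trans[OF abs_ge_zero] by blast
qed

lemma linf_cst [simp]: "cst a \<in> linf"
  by (rule linfI[of _ "\<bar>a\<bar>"]) (simp add: cst_def)

lemma linf_const [simp]: "(\<lambda>t. a) \<in> linf"
  using linf_cst[of a] by (simp add: cst_def)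

lemma linf_add [simp]:
  assumes "x \<in> linf" "y \<in> linf" shows "(\<lambda>t. x t + y t) \<in> linf"
proof -
  obtain B C where "\<And>t. \<bar>x t\<bar> \<le> B" "\<And>t. \<bar>y t\<bar> \<le> C" using assms by (metis linfE)
  then show ?thesis by (intro linfI[of _ "B + C"]) (meson abs_triangle_ineq add_mono order_trans)
qed

lemma linf_cmult [simp]:
  assumes "x \<in> linf" shows "(\<lambda>t. a * x t) \<in> linf"
proof -
  obtain B where "\<And>t. \<bar>x t\<bar> \<le> B" using assms by (metis linfE)
  then show ?thesis by (intro linfI[of _ "\<bar>a\<bar> * B"]) (simp add: abs_mult mult_left_mono)
qed

lemma linf_diff [simp]:
  assumes "x \<in> linf" "y \<in> linf" shows "(\<lambda>t. x t - y t) \<in> linf"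
  using linf_add[OF assms(1) linf_cmult[OF assms(2), of "-1"]] by simp

lemma linf_shift0 [simp]: "x \<in> linf \<Longrightarrow> shift0 x \<in> linf"
  by (elim linfE, rule linfI) (auto simp: shift0_def split: nat.split)

lemma linf_If [simp]:
  assumes "x \<in> linf" "y \<in> linf" shows "(\<lambda>t. if P t then x t else y t) \<in> linf"
proof -
  obtain B C where "\<And>t. \<bar>x t\<bar> \<le> B" "\<And>t. \<bar>y t\<bar> \<le> C" using assms by (metis linfE)
  then show ?thesis by (intro linfI[of _ "max B C"]) (simp add: max.coboundedI1 max.coboundedI2)
qed

lemma linf_splice [simp]: "x \<in> linf \<Longrightarrow> y \<in> linf \<Longrightarrow> splice x A y \<in> linf"
  unfolding splice_def by simp

lemma funpow_shift0: "(shift0 ^^ n) x t = (if t < n then 0 else x (t - n))"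
  by (induction n arbitrary: t) (auto simp: shift0_def split: nat.split)

lemma linf_funpow_shift0 [simp]: "x \<in> linf \<Longrightarrow> (shift0 ^^ n) x \<in> linf"
  by (induction n) auto

section \<open>Linearity, bounds and continuity of discounted values\<close>

lemma summable_disc:
  assumes "x \<in> linf" "0 \<le> \<delta>" "\<delta> < 1"
  shows "summable (\<lambda>t. \<delta> ^ t * x t)"
proof -
  obtain B where B: "B \<ge> 0" "\<And>t. \<bar>x t\<bar> \<le> B" using assms by (metis linfE)
  show ?thesis
  proof (rule summable_comparison_test')
    show "summable (\<lambda>t. \<delta> ^ t * B)"
      using assms by (intro summable_mult2 summable_geometric) auto
    show "norm (\<delta> ^ t * x t) \<le> \<delta> ^ t * B" if "t \<ge> 0" for t
      using B assms by (simp add: abs_mult mult_left_mono)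
  qed
qed

lemma disc_val_add:
  assumes "x \<in> linf" "y \<in> linf" "0 \<le> \<delta>" "\<delta> < 1"
  shows "disc_val \<delta> (\<lambda>t. x t + y t) = disc_val \<delta> x + disc_val \<delta> y"
  using suminf_add[OF summable_disc[OF assms(1,3,4)] summable_disc[OF assms(2,3,4)], symmetric]
  unfolding disc_val_def by (simp add: distrib_left)

lemma disc_val_cmult:
  assumes "x \<in> linf" "0 \<le> \<delta>" "\<delta> < 1"
  shows "disc_val \<delta> (\<lambda>t. a * x t) = a * disc_val \<delta> x"
  using suminf_mult[OF summable_disc[OF assms], of a]
  unfolding disc_val_def by (simp add: algebra_simps)

lemma disc_val_diff:
  assumes "x \<in> linf" "y \<in> linf" "0 \<le> \<delta>" "\<delta> < 1"
  shows "disc_val \<delta> (\<lambda>t. x t - y t) = disc_val \<delta> x - disc_val \<delta> y"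
  using disc_val_add[OF assms(1) linf_cmult[OF assms(2), of "-1"] assms(3,4)]
    disc_val_cmult[OF assms(2-4), of "-1"] by simp

lemma disc_val_const:
  assumes "0 \<le> \<delta>" "\<delta> < 1"
  shows "disc_val \<delta> (\<lambda>t. a) = a"
  using assms suminf_mult2[of "\<lambda>t. \<delta> ^ t" a, symmetric] unfolding disc_val_def
  by (simp add: suminf_geometric summable_geometric)

lemma disc_val_cst: "0 \<le> \<delta> \<Longrightarrow> \<delta> < 1 \<Longrightarrow> disc_val \<delta> (cst a) = a"
  unfolding cst_def by (rule disc_val_const)

lemma disc_val_mono:
  assumes "x \<in> linf" "y \<in> linf" "0 \<le> \<delta>" "\<delta> < 1" "\<And>t. x t \<le> y t"
  shows "disc_val \<delta> x \<le> disc_val \<delta> y"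
  unfolding disc_val_def
  by (intro mult_left_mono suminf_le summable_disc) (use assms in auto)

lemma disc_val_shift0:
  assumes "x \<in> linf" "0 \<le> \<delta>" "\<delta> < 1"
  shows "disc_val \<delta> (shift0 x) = \<delta> * disc_val \<delta> x"
proof -
  have "(\<Sum>t. \<delta> ^ t * shift0 x t) = (\<Sum>t. \<delta> ^ Suc t * shift0 x (Suc t))"
    using suminf_split_head[OF summable_disc[OF linf_shift0[OF assms(1)] assms(2,3)]]
    by (simp add: shift0_def)
  also have "\<dots> = \<delta> * (\<Sum>t. \<delta> ^ t * x t)"
    using suminf_mult[OF summable_disc[OF assms], of \<delta>] by (simp add: shift0_def mult.assoc)
  finally show ?thesis by (simp add: disc_val_def)
qed

lemma disc_val_funpow_shift0:
  assumes "x \<in> linf" "0 \<le> \<delta>" "\<delta> < 1"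
  shows "disc_val \<delta> ((shift0 ^^ n) x) = \<delta> ^ n * disc_val \<delta> x"
  by (induction n) (use assms in \<open>simp_all add: disc_val_shift0\<close>)

lemma disc_val_le:
  assumes "0 \<le> \<delta>" "\<delta> < 1" "\<And>t. \<bar>x t\<bar> \<le> B"
  shows "\<bar>disc_val \<delta> x\<bar> \<le> B"
proof -
  have "disc_val \<delta> x \<le> B" "- B \<le> disc_val \<delta> x"
    using disc_val_mono[of x "\<lambda>t. B" \<delta>] disc_val_mono[of "\<lambda>t. - B" x \<delta>] assms linfI[of x B]
      disc_val_const[OF assms(1,2)]
    by (auto simp: abs_le_iff minus_le_iff)
  then show ?thesis by simp
qed

text \<open>Such an \<open>x\<close> is the \<open>n\<close>-fold right shift of its own tail, and
  each shift contributes one factor \<delta>.\<close>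

lemma disc_val_tail_le:
  assumes "0 \<le> \<delta>" "\<delta> < 1" "\<And>t. \<bar>x t\<bar> \<le> B" "\<And>t. t < n \<Longrightarrow> x t = 0"
  shows "\<bar>disc_val \<delta> x\<bar> \<le> B * \<delta> ^ n"
proof -
  have x: "x = (shift0 ^^ n) (\<lambda>t. x (t + n))"
    using assms(4) by (auto simp: funpow_shift0)
  have "(\<lambda>t. x (t + n)) \<in> linf" by (rule linfI) (rule assms(3))
  then have "disc_val \<delta> x = \<delta> ^ n * disc_val \<delta> (\<lambda>t. x (t + n))"
    using disc_val_funpow_shift0 assms(1,2) x by metis
  moreover have "\<bar>disc_val \<delta> (\<lambda>t. x (t + n))\<bar> \<le> B"
    by (rule disc_val_le) (use assms in auto)
  ultimately show ?thesis using assms(1) by (simp add: abs_mult mult.commute[of B] mult_left_mono)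
qed

text \<open>The closed form makes the limit for \<delta> tending to 1 visible: it is
  \<open>b\<close>, whatever \<open>n\<close>. This is what lower semicontinuity of the cost at 1
  rests on.\<close>

lemma disc_val_step:
  assumes "0 \<le> \<delta>" "\<delta> < 1"
  shows "disc_val \<delta> (\<lambda>t. if t < n then a else b) = a + (b - a) * \<delta> ^ n"
proof -
  have eq: "(\<lambda>t. if t < n then a else b) = (\<lambda>t. cst a t + (shift0 ^^ n) (cst (b - a)) t)"
    by (auto simp: funpow_shift0 cst_def)
  show ?thesis unfolding eq
    by (subst disc_val_add) (use assms in \<open>auto simp: disc_val_funpow_shift0 disc_val_cst\<close>)
qed

lemma isCont_disc_val:
  assumes "x \<in> linf" "0 \<le> \<delta>" "\<delta> < 1"
  shows "isCont (\<lambda>\<delta>. disc_val \<delta> x) \<delta>"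
proof -
  \<comment> \<open>A point strictly between \<delta> and 1: the power series converges there, hence
    is continuous at the smaller point \<delta>.\<close>
  define r where "r = (\<delta> + 1) / 2"
  have r: "\<delta> < r" "r < 1" "0 \<le> r" using assms by (auto simp: r_def)
  have "isCont (\<lambda>\<delta>. \<Sum>t. x t * \<delta> ^ t) \<delta>"
    by (rule isCont_powser[where K = r])
      (use summable_disc[OF assms(1) r(3,2)] r assms in \<open>auto simp: mult.commute\<close>)
  then show ?thesis unfolding disc_val_def by (auto simp: mult.commute intro!: continuous_intros)
qed

section \<open>Shift-invariant cones of bounded sequences\<close>

text \<open>Abstracts the cone of improving directions. \<open>K_neg\<close> keeps the cone proper.
  \<open>K_tail\<close> is the trace of monotone continuity: after a lift by any \<eta> > 0, the
  distant tail may be replaced by an arbitrarily bad constant.\<close>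

locale shift_cone =
  fixes K :: "seq set"
  assumes K_zero: "cst 0 \<in> K"
    and K_linf: "d \<in> K \<Longrightarrow> d \<in> linf"
    and K_add: "d \<in> K \<Longrightarrow> e \<in> K \<Longrightarrow> (\<lambda>t. d t + e t) \<in> K"
    and K_scale: "d \<in> K \<Longrightarrow> a > 0 \<Longrightarrow> (\<lambda>t. a * d t) \<in> K"
    and K_up: "d \<in> K \<Longrightarrow> e \<in> linf \<Longrightarrow> (\<And>t. d t \<le> e t) \<Longrightarrow> e \<in> K"
    and K_shift: "d \<in> K \<Longrightarrow> shift0 d \<in> K"
    and K_neg: "\<epsilon> > 0 \<Longrightarrow> cst (- \<epsilon>) \<notin> K"
    and K_tail: "d \<in> K \<Longrightarrow> \<eta> > 0 \<Longrightarrow> \<exists>n. (\<lambda>t. if t < n then d t + \<eta> else - M) \<in> K"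
begin

lemma K_scale0: "d \<in> K \<Longrightarrow> a \<ge> 0 \<Longrightarrow> (\<lambda>t. a * d t) \<in> K"
  using K_scale[of d a] K_zero by (cases "a = 0") (auto simp: cst_def)

lemma K_sum: "(\<And>i. i \<in> F \<Longrightarrow> x i \<in> K) \<Longrightarrow> (\<lambda>t. \<Sum>i\<in>F. x i t) \<in> K"
  using K_zero by (induction F rule: infinite_finite_induct) (auto simp: cst_def K_add)

lemma K_funpow_shift: "d \<in> K \<Longrightarrow> (shift0 ^^ n) d \<in> K"
  by (induction n) (auto intro: K_shift)

lemma K_not_neg:
  assumes "\<epsilon> > 0" "\<And>t. d t \<le> - \<epsilon>" shows "d \<notin> K"
  using K_up[of d "cst (- \<epsilon>)"] K_neg[OF assms(1)] assms(2) by (auto simp: cst_def)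

text \<open>Take \<open>K_tail\<close> with a bound of \<open>d\<close> as the bad constant: every
  later truncation by 0 dominates the resulting sequence, so \<open>K_up\<close> applies.
  Truncations are coefficient lists of polynomials in \<delta>.\<close>

lemma K_trunc:
  assumes "d \<in> K" "\<eta> > 0"
  obtains n0 where "\<And>n. n \<ge> n0 \<Longrightarrow> (\<lambda>t. if t < n then d t + \<eta> else 0) \<in> K"
proof -
  obtain B where B: "B \<ge> 0" "\<And>t. \<bar>d t\<bar> \<le> B" using K_linf assms by (metis linfE)
  obtain n0 where n0: "(\<lambda>t. if t < n0 then d t + \<eta> else - B) \<in> K" using K_tail assms by blast
  show ?thesis
  proof
    fix n assume n: "n \<ge> n0"
    show "(\<lambda>t. if t < n then d t + \<eta> else 0) \<in> K"
    proof (rule K_up[OF n0])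
      show "(\<lambda>t. if t < n then d t + \<eta> else 0) \<in> linf" using K_linf[OF assms(1)] by simp
      fix t
      have "- B \<le> d t" using B(2)[of t] by linarith
      then show "(if t < n0 then d t + \<eta> else - B) \<le> (if t < n then d t + \<eta> else 0)"
        using n B assms(2) by auto
    qed
  qed
qed

text \<open>If every \<delta> made some \<open>p\<close> negative, a combination of shifts with
  nonnegative weights could be pushed uniformly below 0, against \<open>K_neg\<close>. Which
  \<open>p\<close> is negative depends on \<delta>, so the weights let \<delta> move slowly with
  time. The motion starts at 0, which kills the terms reaching before time 0, and ends at 1, which
  keeps the weights bounded.\<close>

lemma finite_common_nonneg:
  assumes F: "finite F" "F \<subseteq> K" and supp: "\<And>p t. p \<in> F \<Longrightarrow> t \<ge> n \<Longrightarrow> p t = 0"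
  shows "\<exists>\<delta>\<in>{0..1}. \<forall>p\<in>F. (\<Sum>j<n. p j * \<delta> ^ j) \<ge> 0"
proof (rule ccontr)
  assume no: "\<not> ?thesis"
  have supp': "t < n" if "p \<in> F" "p t \<noteq> 0" for p t using supp that by (meson not_le)
  txt \<open>The shift by \<open>s\<close> of \<open>p\<close> gets the weight \<open>g s * w p (\<delta> N s)\<close>, where \<open>g (s - 1) / g s = \<delta> N s\<close>
    climbs from 0 to 1 in steps of size \<open>1 / (N + 1)\<close> and then stays 1. For large \<open>N\<close> the weights
    look geometric locally, so the entry at \<open>t\<close> of the combination is about \<open>g t\<close> times
    \<open>\<Sum>p\<in>F. w p \<delta> * v p \<delta> < 0\<close> at \<open>\<delta> = \<delta> N t\<close>. Cutting the shifts off at some \<open>m\<close> leaves a bounded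
    error beyond \<open>m\<close>, which \<open>K_tail\<close> for the zero sequence absorbs.\<close>
  define v :: "seq \<Rightarrow> real \<Rightarrow> real" where "v p \<delta> = (\<Sum>j<n. p j * \<delta> ^ j)" for p \<delta>
  \<comment> \<open>With the negative part of \<open>v p\<close> as weight, each product
    \<open>w p \<delta> * v p \<delta>\<close> is minus a square of that part: never positive, and
    strictly negative for some \<open>p\<close> at every \<delta> in the unit interval.\<close>
  define w where "w p \<delta> = max 0 (- v p \<delta>)" for p \<delta>
  have cont_v: "continuous_on S (v p)" for p S
    unfolding v_def by (intro continuous_intros)
  have cont_w: "continuous_on S (w p)" for p S
    unfolding w_def by (intro continuous_intros cont_v)
  have w_nonneg: "w p \<delta> \<ge> 0" for p \<delta> by (simp add: w_def)
  have \<Phi>_neg: "(\<Sum>p\<in>F. w p \<delta> * v p \<delta>) < 0" if "\<delta> \<in> {0..1}" for \<delta>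
  proof -
    obtain q where q: "q \<in> F" "v q \<delta> < 0" using no \<open>\<delta> \<in> {0..1}\<close> unfolding v_def by (meson not_le)
    have "(\<Sum>p\<in>F. w p \<delta> * v p \<delta>) < (\<Sum>p\<in>F. 0)"
    proof (rule sum_strict_mono_ex1[OF F(1)])
      show "\<forall>p\<in>F. w p \<delta> * v p \<delta> \<le> 0"
        by (auto simp: w_def max_def mult_le_0_iff)
      show "\<exists>p\<in>F. w p \<delta> * v p \<delta> < 0"
        using q by (auto intro!: bexI[of _ q] simp: w_def max_def mult_less_0_iff)
    qed
    then show ?thesis by simp
  qed
  define \<delta> where "\<delta> N s = min 1 (real s / real (Suc N))" for N s
  have \<delta>01: "\<delta> N s \<in> {0..1}" for N s by (simp add: \<delta>_def)
  \<comment> \<open>This is the entry at \<open>t\<close> of the combination divided by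
    \<open>g t\<close>, the product being the ratio \<open>g (t - j) / g t\<close>. Truncated
    subtraction does no harm: for \<open>j > t\<close> the factor with \<open>r = t\<close> is
    \<open>\<delta> N 0 = 0\<close>.\<close>
  define H where "H N t = (\<Sum>p\<in>F. \<Sum>j<n. (\<Prod>r<j. \<delta> N (t - r)) * w p (\<delta> N (t - j)) * p j)" for N t
  \<comment> \<open>By compactness: otherwise bad times \<tau> exist for every \<open>N\<close>, and
    along a subsequence \<delta> at these times tends to some \<open>l\<close>. The \<open>H\<close>
    values then tend to the sum of \<open>w p l * v p l\<close>, which would be nonnegative because
    the threshold vanishes as \<open>N\<close> grows.\<close>
  have "\<exists>N. \<forall>t. H N t < - 1 / real (Suc N)"
  proof (rule ccontr)
    assume "\<nexists>N. \<forall>t. H N t < - 1 / real (Suc N)"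
    then obtain \<tau> where \<tau>: "H N (\<tau> N) \<ge> - 1 / real (Suc N)" for N by (metis not_le)
    obtain l \<rho> where l: "l \<in> {0..1}" "strict_mono \<rho>" "((\<lambda>N. \<delta> N (\<tau> N)) \<circ> \<rho>) \<longlonglongrightarrow> l"
      using compact_Icc[of 0 "1::real"] \<delta>01 unfolding compact_def by metis
    have inv0: "(\<lambda>N. real r / real (Suc (\<rho> N))) \<longlonglongrightarrow> 0" for r
    proof -
      have "(\<lambda>N. real r * inverse (real (Suc N))) \<longlonglongrightarrow> real r * 0"
        by (intro tendsto_intros LIMSEQ_inverse_real_of_nat)
      then have "((\<lambda>N. real r / real (Suc N)) \<circ> \<rho>) \<longlonglongrightarrow> 0"
        by (intro LIMSEQ_subseq_LIMSEQ l) (simp add: field_simps)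
      then show ?thesis by (simp add: o_def)
    qed
    \<comment> \<open>Going back \<open>r\<close> dates changes \<delta> by at most
      \<open>r / (N + 1)\<close>, so all values entering \<open>H\<close> share the limit
      \<open>l\<close>.\<close>
    have lim: "(\<lambda>N. \<delta> (\<rho> N) (\<tau> (\<rho> N) - r)) \<longlonglongrightarrow> l" for r
    proof -
      have "\<bar>\<delta> N (t - r) - \<delta> N t\<bar> \<le> real r / real (Suc N)" for N t
      proof -
        have "real t / real (Suc N) - real r / real (Suc N) \<le> real (t - r) / real (Suc N)"
          unfolding diff_divide_distrib[symmetric] by (intro divide_right_mono) auto
        moreover have "real (t - r) / real (Suc N) \<le> real t / real (Suc N)"
          by (intro divide_right_mono) auto
        moreover have "0 \<le> real r / real (Suc N)" by simp
        ultimately show ?thesis unfolding \<delta>_def by linarith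
      qed
      then have "(\<lambda>N. \<delta> (\<rho> N) (\<tau> (\<rho> N) - r) - \<delta> (\<rho> N) (\<tau> (\<rho> N))) \<longlonglongrightarrow> 0"
        by (intro Lim_null_comparison[OF _ inv0[of r]] always_eventually) auto
      from tendsto_add[OF this l(3)[unfolded o_def]] show ?thesis by simp
    qed
    have "(\<lambda>N. w p (\<delta> (\<rho> N) (\<tau> (\<rho> N) - j))) \<longlonglongrightarrow> w p l" for p j
      using continuous_on_tendsto_compose[OF cont_w[of UNIV p] lim] by simp
    then have "(\<lambda>N. H (\<rho> N) (\<tau> (\<rho> N))) \<longlonglongrightarrow> (\<Sum>p\<in>F. \<Sum>j<n. (\<Prod>r<j. l) * w p l * p j)"
      unfolding H_def by (intro tendsto_intros lim)
    also have "(\<Sum>p\<in>F. \<Sum>j<n. (\<Prod>r<j. l) * w p l * p j) = (\<Sum>p\<in>F. w p l * v p l)"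
      by (simp add: v_def sum_distrib_left mult_ac)
    finally have "(\<Sum>p\<in>F. w p l * v p l) \<ge> 0"
    proof (rule LIMSEQ_le[rotated])
      show "(\<lambda>N. - (real 1 / real (Suc (\<rho> N)))) \<longlonglongrightarrow> 0"
        using tendsto_minus[OF inv0[of 1]] by simp
      show "\<exists>N. \<forall>n\<ge>N. - (real 1 / real (Suc (\<rho> n))) \<le> H (\<rho> n) (\<tau> (\<rho> n))"
        using \<tau> by auto
    qed
    with \<Phi>_neg[OF l(1)] show False by simp
  qed
  then obtain N where N: "\<And>t. H N t < - 1 / real (Suc N)" by blast
  define \<kappa> where "\<kappa> = 1 / real (Suc N)"
  have \<kappa>: "\<kappa> > 0" by (simp add: \<kappa>_def)
  define \<gamma> where "\<gamma> = \<delta> N"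
  have \<gamma>: "0 \<le> \<gamma> s" "\<gamma> s \<le> 1" "\<gamma> (Suc s) > 0" "\<gamma> 0 = 0" "s > N \<Longrightarrow> \<gamma> s = 1" for s
    by (auto simp: \<gamma>_def \<delta>_def min_def)
  \<comment> \<open>Only \<gamma> at successors is inverted, so the zero value
    \<open>\<gamma> 0\<close> causes no division by zero.\<close>
  define g where "g s = (\<Prod>r<s. inverse (\<gamma> (Suc r)))" for s
  have g_Suc: "g (Suc s) = g s / \<gamma> (Suc s)" for s by (simp add: g_def field_simps)
  have g_ge: "g s \<ge> 1" for s
    unfolding g_def by (rule prod_ge_1) (use \<gamma> in \<open>auto simp: one_le_inverse_iff\<close>)
  have g_back: "g (t - j) = g t * (\<Prod>r<j. \<gamma> (t - r))" if "j \<le> t" for t j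
    using that
  proof (induction j)
    case (Suc j)
    then have "g (t - j) = g (t - Suc j) / \<gamma> (t - j)"
      using g_Suc[of "t - Suc j"] by (simp add: Suc_diff_Suc)
    moreover have "\<gamma> (t - j) > 0" using \<gamma>(3)[of "t - Suc j"] Suc.prems by (simp add: Suc_diff_Suc)
    ultimately show ?case using Suc by (simp add: field_simps)
  qed auto
  \<comment> \<open>The growth factors are at least 1 and equal 1 beyond \<open>N\<close>, so
    \<open>g\<close> increases up to \<open>N\<close> and is constant afterwards.\<close>
  have g_le: "g s \<le> g N" for s
  proof (cases "s \<le> N")
    case True
    have "g m \<le> g (Suc m)" for m
      using g_ge[of m] \<gamma>(2,3) by (simp add: g_Suc le_divide_eq mult_left_le)
    with True show ?thesis by (simp add: lift_Suc_mono_le)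
  next
    case False
    then have "g N = g s * (\<Prod>r<s - N. \<gamma> (s - r))" using g_back[of "s - N" s] by simp
    also have "(\<Prod>r<s - N. \<gamma> (s - r)) = 1" by (rule prod.neutral) (use \<gamma>(5) in auto)
    finally show ?thesis by simp
  qed
  define a where "a p s = g s * w p (\<gamma> s)" for p s
  have a_nonneg: "a p s \<ge> 0" for p s using g_ge[of s] w_nonneg by (simp add: a_def)
  have "\<exists>A\<ge>0. \<forall>p\<in>F. \<forall>s. a p s \<le> A"
  proof -
    have "\<exists>W\<ge>0. \<forall>\<delta>\<in>{0..1}. w p \<delta> \<le> W" for p
    proof -
      obtain z where "z \<in> {0..1}" "\<forall>y\<in>{0..1}. w p y \<le> w p z"
        using continuous_attains_sup[OF compact_Icc _ cont_w, of 0 1 p] by auto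
      then show ?thesis using w_nonneg by blast
    qed
    then obtain W where W: "\<And>p. W p \<ge> 0" "\<And>p \<delta>. \<delta> \<in> {0..1} \<Longrightarrow> w p \<delta> \<le> W p" by metis
    have "a p s \<le> g N * (\<Sum>p\<in>F. W p)" if "p \<in> F" for p s
    proof -
      have "w p (\<gamma> s) \<le> W p" using W(2) \<gamma> by simp
      also have "\<dots> \<le> (\<Sum>p\<in>F. W p)" using F that W(1) by (simp add: member_le_sum)
      finally show ?thesis unfolding a_def
        using g_le[of s] g_ge[of s] w_nonneg by (intro mult_mono) auto
    qed
    moreover have "0 \<le> g N * (\<Sum>p\<in>F. W p)" using g_ge[of N] W(1) by (simp add: sum_nonneg)
    ultimately show ?thesis by blast
  qed
  then obtain A where A: "A \<ge> 0" "\<And>p s. p \<in> F \<Longrightarrow> a p s \<le> A" by blast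
  \<comment> \<open>\<open>C\<close> will bound the combination beyond the cutoff \<open>m\<close>.
    It does not depend on \<open>m\<close>, so \<open>m\<close> may be chosen after it.\<close>
  define C where "C = A * (\<Sum>p\<in>F. \<Sum>j<n. \<bar>p j\<bar>)"
  obtain m where m: "(\<lambda>t. if t < m then cst 0 t + \<kappa> / 2 else - (C + 1)) \<in> K"
    using K_tail[OF K_zero, of "\<kappa> / 2" "C + 1"] \<kappa> by auto
  define e where "e t = (\<Sum>p\<in>F. \<Sum>s<m. a p s * (shift0 ^^ s) p t)" for t
  have eK: "e \<in> K" unfolding e_def
    by (intro K_sum K_scale0 K_funpow_shift a_nonneg) (use F in auto)
  \<comment> \<open>The support of \<open>p\<close> limits the convolution to \<open>j < n\<close>;
    the conditional drops the shifts \<open>t - j\<close> that would be negative.\<close>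
  have conv: "(\<Sum>s\<in>{..t}. f s * p (t - s)) = (\<Sum>j<n. if j \<le> t then f (t - j) * p j else 0)"
    if "p \<in> F" for f p t
  proof -
    have "(\<Sum>s\<in>{..t}. f s * p (t - s)) = (\<Sum>j\<in>{..t}. f (t - j) * p j)"
      by (rule sum.reindex_bij_witness[of _ "\<lambda>j. t - j" "\<lambda>j. t - j"]) auto
    also have "\<dots> = (\<Sum>j\<in>{..t} \<inter> {..<n}. f (t - j) * p j)"
      by (rule sum.mono_neutral_right) (use supp'[OF that] in auto)
    also have "\<dots> = (\<Sum>j\<in>{..<n} \<inter> {j. j \<le> t}. f (t - j) * p j)"
      by (rule sum.cong) auto
    finally show ?thesis by (simp add: sum.inter_restrict)
  qed
  have e_small: "e t \<le> - \<kappa>" if "t < m" for t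
  proof -
    have "(\<Sum>s<m. a p s * (shift0 ^^ s) p t) =
        (\<Sum>j<n. g t * ((\<Prod>r<j. \<delta> N (t - r)) * w p (\<delta> N (t - j)) * p j))" if "p \<in> F" for p
    proof -
      have "(\<Sum>s<m. a p s * (shift0 ^^ s) p t) = (\<Sum>s\<in>{..t}. a p s * p (t - s))"
        by (rule sum.mono_neutral_cong_right) (use \<open>t < m\<close> in \<open>auto simp: funpow_shift0\<close>)
      also have "\<dots> = (\<Sum>j<n. if j \<le> t then a p (t - j) * p j else 0)" by (rule conv[OF that])
      also have "\<dots> = (\<Sum>j<n. g t * ((\<Prod>r<j. \<delta> N (t - r)) * w p (\<delta> N (t - j)) * p j))"
      proof (rule sum.cong[OF refl])
        fix j
        show "(if j \<le> t then a p (t - j) * p j else 0) =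
            g t * ((\<Prod>r<j. \<delta> N (t - r)) * w p (\<delta> N (t - j)) * p j)"
        proof (cases "j \<le> t")
          case True
          then show ?thesis using g_back[OF True] by (simp add: a_def \<gamma>_def)
        next
          case False
          then have "(\<Prod>r<j. \<delta> N (t - r)) = 0"
            by (intro prod_zero bexI[of _ t]) (use \<gamma>(4) in \<open>auto simp: \<gamma>_def\<close>)
          with False show ?thesis by simp
        qed
      qed
      finally show ?thesis .
    qed
    then have "e t = g t * H N t" by (simp add: e_def H_def sum_distrib_left)
    also have "\<dots> \<le> g t * (- \<kappa>)"
      using N[of t] g_ge[of t] by (intro mult_left_mono) (auto simp: \<kappa>_def)
    also have "\<dots> \<le> - \<kappa>" using g_ge[of t] \<kappa> by simp
    finally show ?thesis .
  qed
  have e_large: "e t \<le> C" if "\<not> t < m" for t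
  proof -
    have "(\<Sum>s<m. a p s * (shift0 ^^ s) p t) \<le> A * (\<Sum>j<n. \<bar>p j\<bar>)" if "p \<in> F" for p
    proof -
      have "(\<Sum>s<m. a p s * (shift0 ^^ s) p t) = (\<Sum>s<m. a p s * p (t - s))"
        by (rule sum.cong) (use \<open>\<not> t < m\<close> in \<open>auto simp: funpow_shift0\<close>)
      also have "\<dots> \<le> (\<Sum>s<m. A * \<bar>p (t - s)\<bar>)"
      proof (rule sum_mono)
        fix s
        have "a p s * p (t - s) \<le> a p s * \<bar>p (t - s)\<bar>" using a_nonneg by (intro mult_left_mono) auto
        also have "\<dots> \<le> A * \<bar>p (t - s)\<bar>" using A that by (intro mult_right_mono) auto
        finally show "a p s * p (t - s) \<le> A * \<bar>p (t - s)\<bar>" .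
      qed
      also have "\<dots> = A * (\<Sum>s<m. \<bar>p (t - s)\<bar>)" by (simp add: sum_distrib_left)
      \<comment> \<open>As \<open>s < m \<le> t\<close>, distinct \<open>s\<close> give distinct
        \<open>t - s\<close>, so every entry of \<open>p\<close> is counted at most once, however
        large \<open>m\<close> is.\<close>
      also have "(\<Sum>s<m. \<bar>p (t - s)\<bar>) = (\<Sum>j\<in>(\<lambda>s. t - s) ` {..<m}. \<bar>p j\<bar>)"
        by (subst sum.reindex) (use \<open>\<not> t < m\<close> in \<open>auto simp: inj_on_def\<close>)
      also have "\<dots> = (\<Sum>j\<in>(\<lambda>s. t - s) ` {..<m} \<inter> {..<n}. \<bar>p j\<bar>)"
        by (rule sum.mono_neutral_right) (use supp'[OF that] in auto)
      also have "\<dots> \<le> (\<Sum>j<n. \<bar>p j\<bar>)"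
        by (rule sum_mono2) auto
      finally show ?thesis using A(1) by (simp add: mult_left_mono)
    qed
    then show ?thesis unfolding e_def C_def by (simp add: sum_distrib_left sum_mono)
  qed
  \<comment> \<open>Below \<open>m\<close> the sum is at most
    \<open>- \<kappa> + \<kappa> / 2\<close>, and from \<open>m\<close> on at most
    \<open>C - (C + 1)\<close>.\<close>
  have "(\<lambda>t. e t + (if t < m then cst 0 t + \<kappa> / 2 else - (C + 1))) \<notin> K"
    by (rule K_not_neg[of "min (\<kappa> / 2) 1"])
      (use e_small e_large \<kappa> in \<open>fastforce simp: cst_def min_def\<close>)+
  then show False using K_add[OF eK m] by simp
qed

text \<open>For truncated members the condition is polynomial in \<delta>, hence closed, and the
  finite case gives a common \<delta> by compactness. A general \<open>d\<close> follows by lifting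
  it by \<eta>, truncating ever later, and letting \<eta> tend to 0.\<close>

theorem common_discount: "\<exists>\<delta>\<in>{0..<1}. \<forall>d\<in>K. disc_val \<delta> d \<ge> 0"
proof -
  define P where "P = {(n, p). (\<lambda>t. if t < n then p t else 0) \<in> K}"
  define v :: "nat \<times> seq \<Rightarrow> real \<Rightarrow> real" where "v q \<delta> = (\<Sum>j<fst q. snd q j * \<delta> ^ j)" for q \<delta>
  have "{0..1} \<inter> (\<Inter>q\<in>P. {\<delta>. v q \<delta> \<ge> 0}) \<noteq> {}"
  proof (rule compact_imp_fip_image[OF compact_Icc])
    show "closed {\<delta>. v q \<delta> \<ge> 0}" for q
      unfolding v_def by (intro closed_Collect_le continuous_intros)
    fix Q assume Q: "finite Q" "Q \<subseteq> P"
    define tr :: "nat \<times> seq \<Rightarrow> seq" where "tr q = (\<lambda>t. if t < fst q then snd q t else 0)" for q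
    \<comment> \<open>A common length for all truncations; inserting 0 covers the case of empty
      \<open>Q\<close>.\<close>
    define n where "n = Max (insert 0 (fst ` Q))"
    have n: "fst q \<le> n" if "q \<in> Q" for q
      unfolding n_def using Q(1) that by (intro Max_ge) auto
    have "\<exists>\<delta>\<in>{0..1}. \<forall>p\<in>tr ` Q. (\<Sum>j<n. p j * \<delta> ^ j) \<ge> 0"
    proof (rule finite_common_nonneg)
      show "finite (tr ` Q)" using Q by simp
      have "tr q \<in> K" if "q \<in> P" for q using that by (cases q) (simp add: P_def tr_def cong: if_cong)
      then show "tr ` Q \<subseteq> K" using Q(2) by blast
      fix p t assume "p \<in> tr ` Q" "n \<le> t"
      then show "p t = 0" using n by (fastforce simp: tr_def)
    qed
    then obtain \<delta> where \<delta>: "\<delta> \<in> {0..1}" "\<And>q. q \<in> Q \<Longrightarrow> (\<Sum>j<n. tr q j * \<delta> ^ j) \<ge> 0" by auto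
    have "(\<Sum>j<n. tr q j * \<delta> ^ j) = v q \<delta>" if "q \<in> Q" for q
      unfolding v_def by (rule sum.mono_neutral_cong_right) (use n[OF that] in \<open>auto simp: tr_def\<close>)
    with \<delta> have "\<delta> \<in> {0..1} \<inter> (\<Inter>q\<in>Q. {\<delta>. v q \<delta> \<ge> 0})" by auto
    then show "{0..1} \<inter> (\<Inter>q\<in>Q. {\<delta>. v q \<delta> \<ge> 0}) \<noteq> {}" by blast
  qed
  then obtain \<delta> where "\<delta> \<in> {0..1} \<inter> (\<Inter>q\<in>P. {\<delta>. v q \<delta> \<ge> 0})" by blast
  then have \<delta>: "0 \<le> \<delta>" "\<delta> \<le> 1" and vP: "\<forall>q\<in>P. v q \<delta> \<ge> 0"
    by simp_all
  have pos: "(\<Sum>j<n. p j * \<delta> ^ j) \<ge> 0" if "(\<lambda>t. if t < n then p t else 0) \<in> K" for n p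
    using bspec[OF vP, of "(n, p)"] that by (simp add: P_def v_def)
  have "\<delta> \<noteq> 1"
  proof
    assume "\<delta> = 1"
    obtain n where n: "(\<lambda>t. if t < n then cst 0 t + 1 else - 2) \<in> K"
      using K_tail[OF K_zero, of 1] by auto
    \<comment> \<open>At \<delta> = 1 the polynomial value is the plain sum. Keeping
      \<open>n + 1\<close> entries \<open>- 2\<close> after the \<open>n\<close> entries 1 makes it
      \<open>n - 2 * (n + 1) < 0\<close>, and replacing the later entries by 0 only raises the
      sequence.\<close>
    define p :: seq where "p t = (if t < n then 1 else - 2)" for t
    have "(\<lambda>t. if t < n + (n + 1) then p t else 0) \<in> K"
      by (rule K_up[OF n]) (auto simp: p_def cst_def)
    from pos[OF this] have "(\<Sum>j<n + (n + 1). p j) \<ge> 0" using \<open>\<delta> = 1\<close> by simp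
    moreover have "(\<Sum>j<n + (n + 1). p j) = (\<Sum>j<n. p j) + (\<Sum>j\<in>{n..<n + (n + 1)}. p j)"
      using sum.atLeastLessThan_concat[of 0 n "n + (n + 1)" p] by (simp add: lessThan_atLeast0)
    moreover have "(\<Sum>j<n. p j) = n" by (simp add: p_def)
    moreover have "(\<Sum>j\<in>{n..<n + (n + 1)}. p j) = - 2 * (n + 1)" by (simp add: p_def)
    ultimately show False by simp
  qed
  with \<delta> have \<delta>1: "\<delta> < 1" by simp
  have "disc_val \<delta> d \<ge> 0" if d: "d \<in> K" for d
  proof (rule field_le_epsilon)
    fix \<eta> :: real assume \<eta>: "\<eta> > 0"
    have dl: "d \<in> linf" by (rule K_linf[OF d])
    obtain n0 where n0: "\<And>n. n \<ge> n0 \<Longrightarrow> (\<lambda>t. if t < n then d t + \<eta> else 0) \<in> K"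
      using K_trunc[OF d \<eta>] by metis
    have "summable (\<lambda>t. \<delta> ^ t * (d t + \<eta>))"
      by (rule summable_disc) (use dl \<delta> \<delta>1 in auto)
    then have "(\<lambda>n. \<Sum>j<n. \<delta> ^ j * (d j + \<eta>)) \<longlonglongrightarrow> (\<Sum>t. \<delta> ^ t * (d t + \<eta>))"
      by (rule summable_LIMSEQ)
    moreover have "(\<Sum>j<n. \<delta> ^ j * (d j + \<eta>)) \<ge> 0" if "n \<ge> n0" for n
      using pos[OF n0[OF that]] by (simp add: mult.commute)
    ultimately have "(\<Sum>t. \<delta> ^ t * (d t + \<eta>)) \<ge> 0"
      by (intro LIMSEQ_le_const) auto
    then have "0 \<le> disc_val \<delta> (\<lambda>t. d t + \<eta>)" using \<delta>1 by (simp add: disc_val_def)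
    also have "\<dots> = disc_val \<delta> d + \<eta>"
      using disc_val_add[OF dl linf_const, of \<delta> \<eta>] \<delta> \<delta>1 by (simp add: disc_val_const)
    finally show "0 \<le> disc_val \<delta> d + \<eta>" .
  qed
  with \<delta> \<delta>1 show ?thesis by (intro bexI[of _ \<delta>]) auto
qed

end

section \<open>From the axioms to the cost function\<close>

text \<open>The axioms restated for the constant equivalent. Monotone continuity is kept only for
  the tails \<open>{n..}\<close>.\<close>

locale discounting_functional =
  fixes I :: "seq \<Rightarrow> real"
  assumes I_mono: "x \<in> linf \<Longrightarrow> y \<in> linf \<Longrightarrow> (\<And>t. x t \<le> y t) \<Longrightarrow> I x \<le> I y"
    and I_cst: "I (cst a) = a"
    and I_transl: "x \<in> linf \<Longrightarrow> I (\<lambda>t. x t + a) = I x + a"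
    and I_quasiconcave: "x \<in> linf \<Longrightarrow> y \<in> linf \<Longrightarrow> \<theta> \<le> I x \<Longrightarrow> \<theta> \<le> I y \<Longrightarrow> l \<in> {0..1} \<Longrightarrow>
        \<theta> \<le> I (\<lambda>t. l * x t + (1 - l) * y t)"
    and I_mono_cont: "x \<in> linf \<Longrightarrow> \<theta> < I x \<Longrightarrow> \<exists>n. \<theta> < I (\<lambda>t. if t < n then x t else k)"
    and I_IDIS: "x \<in> linf \<Longrightarrow> d \<in> linf \<Longrightarrow> I x \<le> I (\<lambda>t. x t + d t) \<Longrightarrow> I x \<le> I (\<lambda>t. x t + shift0 d t)"
begin

lemma shift_cone_improving:
  assumes x: "x \<in> linf"
  shows "shift_cone {d \<in> linf. \<exists>\<epsilon>>0. I x \<le> I (\<lambda>t. x t + \<epsilon> * d t)}" (is "shift_cone ?K")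
proof
  show "cst 0 \<in> ?K" by (auto simp: cst_def intro: exI[of _ 1])
  show "d \<in> linf" if "d \<in> ?K" for d using that by simp
  show "(\<lambda>t. d t + e t) \<in> ?K" if de: "d \<in> ?K" "e \<in> ?K" for d e
  proof -
    obtain \<alpha> \<beta> where \<alpha>: "\<alpha> > 0" "I x \<le> I (\<lambda>t. x t + \<alpha> * d t)"
      and \<beta>: "\<beta> > 0" "I x \<le> I (\<lambda>t. x t + \<beta> * e t)" using de by auto
    \<comment> \<open>This mixing weight gives both directions the same step size:
      \<open>l * \<alpha>\<close> and \<open>(1 - l) * \<beta>\<close> both equal
      \<open>\<alpha> * \<beta> / (\<alpha> + \<beta>)\<close>.\<close>
    define l where "l = \<beta> / (\<alpha> + \<beta>)"
    have l: "l \<in> {0..1}" "1 - l = \<alpha> / (\<alpha> + \<beta>)" using \<alpha> \<beta> by (auto simp: l_def field_simps)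
    have "I x \<le> I (\<lambda>t. l * (x t + \<alpha> * d t) + (1 - l) * (x t + \<beta> * e t))"
      by (rule I_quasiconcave) (use x de \<alpha> \<beta> l in auto)
    also have "(\<lambda>t. l * (x t + \<alpha> * d t) + (1 - l) * (x t + \<beta> * e t)) =
        (\<lambda>t. x t + \<alpha> * \<beta> / (\<alpha> + \<beta>) * (d t + e t))"
      unfolding l(2) unfolding l_def using \<alpha> \<beta> by (intro ext) (simp add: divide_simps, simp add: algebra_simps)
    finally show ?thesis using de \<alpha> \<beta> by (auto intro!: exI[of _ "\<alpha> * \<beta> / (\<alpha> + \<beta>)"])
  qed
  show "(\<lambda>t. a * d t) \<in> ?K" if d: "d \<in> ?K" and a: "a > 0" for d a
  proof -
    obtain \<epsilon> where "\<epsilon> > 0" "I x \<le> I (\<lambda>t. x t + \<epsilon> * d t)" using d by auto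
    then show ?thesis using d a by (auto intro!: exI[of _ "\<epsilon> / a"])
  qed
  show "e \<in> ?K" if d: "d \<in> ?K" and e: "e \<in> linf" "\<And>t. d t \<le> e t" for d e
  proof -
    obtain \<epsilon> where \<epsilon>: "\<epsilon> > 0" "I x \<le> I (\<lambda>t. x t + \<epsilon> * d t)" using d by auto
    note \<epsilon>(2)
    also have "I (\<lambda>t. x t + \<epsilon> * d t) \<le> I (\<lambda>t. x t + \<epsilon> * e t)"
      by (rule I_mono) (use x d e \<epsilon> in auto)
    finally show ?thesis using e \<epsilon>(1) by auto
  qed
  show "shift0 d \<in> ?K" if d: "d \<in> ?K" for d
  proof -
    obtain \<epsilon> where \<epsilon>: "\<epsilon> > 0" "I x \<le> I (\<lambda>t. x t + \<epsilon> * d t)" using d by auto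
    then have "I x \<le> I (\<lambda>t. x t + shift0 (\<lambda>t. \<epsilon> * d t) t)"
      using x d by (intro I_IDIS) auto
    also have "shift0 (\<lambda>t. \<epsilon> * d t) = (\<lambda>t. \<epsilon> * shift0 d t)"
      by (auto simp: shift0_def split: nat.split)
    finally show ?thesis using d \<epsilon>(1) by auto
  qed
  show "cst (- \<epsilon>) \<notin> ?K" if \<epsilon>: "\<epsilon> > 0" for \<epsilon>
  proof
    assume "cst (- \<epsilon>) \<in> ?K"
    then obtain \<alpha> where "\<alpha> > 0" "I x \<le> I (\<lambda>t. x t + - (\<alpha> * \<epsilon>))" by (auto simp: cst_def)
    with \<epsilon> show False unfolding I_transl[OF x] by (simp add: mult_le_0_iff)
  qed
  show "\<exists>n. (\<lambda>t. if t < n then d t + \<eta> else - M) \<in> ?K" if d: "d \<in> ?K" and \<eta>: "\<eta> > 0" for d \<eta> M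
  proof -
    obtain \<epsilon> where \<epsilon>: "\<epsilon> > 0" "I x \<le> I (\<lambda>t. x t + \<epsilon> * d t)" using d by auto
    have dl: "d \<in> linf" using d by simp
    obtain B where B: "\<And>t. \<bar>x t\<bar> \<le> B" using x by (metis linfE)
    \<comment> \<open>The lift by \<eta> makes the improvement strict, as monotone continuity
      requires. The tail constant \<open>- B - \<epsilon> * M\<close> used next lies below
      \<open>x t - \<epsilon> * M\<close> at every date.\<close>
    have "I x < I (\<lambda>t. x t + \<epsilon> * d t) + \<epsilon> * \<eta>" using \<epsilon>(2) mult_pos_pos[OF \<epsilon>(1) \<eta>] by linarith
    also have "\<dots> = I (\<lambda>t. x t + \<epsilon> * d t + \<epsilon> * \<eta>)"
      using x dl by (subst I_transl) auto
    finally obtain n where n: "I x < I (\<lambda>t. if t < n then x t + \<epsilon> * d t + \<epsilon> * \<eta> else - B - \<epsilon> * M)"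
      using I_mono_cont[of "\<lambda>t. x t + \<epsilon> * d t + \<epsilon> * \<eta>" "I x"] x dl by auto
    also have "\<dots> \<le> I (\<lambda>t. x t + \<epsilon> * (if t < n then d t + \<eta> else - M))"
    proof (rule I_mono)
      fix t
      have "- B \<le> x t" using B[of t] by linarith
      then show "(if t < n then x t + \<epsilon> * d t + \<epsilon> * \<eta> else - B - \<epsilon> * M)
          \<le> x t + \<epsilon> * (if t < n then d t + \<eta> else - M)"
        by (simp add: algebra_simps)
    qed (use x dl in auto)
    finally show ?thesis using \<epsilon>(1) dl by (auto intro!: exI[of _ n] exI[of _ \<epsilon>])
  qed
qed

text \<open>For any \<open>y\<close>, translating \<open>y - x\<close> by \<open>I x - I y\<close>
  gives a direction that leaves the value at \<open>x\<close> unchanged, hence one in the cone.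
  Nonnegativity of its discounted value is the claimed inequality.\<close>

lemma supergradient:
  assumes x: "x \<in> linf"
  shows "\<exists>\<delta>\<in>{0..<1}. \<forall>y\<in>linf. I y - disc_val \<delta> y \<le> I x - disc_val \<delta> x"
proof -
  define K where "K = {d \<in> linf. \<exists>\<epsilon>>0. I x \<le> I (\<lambda>t. x t + \<epsilon> * d t)}"
  obtain \<delta> where \<delta>: "\<delta> \<in> {0..<1}" "\<And>d. d \<in> K \<Longrightarrow> disc_val \<delta> d \<ge> 0"
    using shift_cone.common_discount[OF shift_cone_improving[OF x]] unfolding K_def by blast
  have "I y - disc_val \<delta> y \<le> I x - disc_val \<delta> x" if y: "y \<in> linf" for y
  proof -
    define d where "d t = (y t - x t) + (I x - I y)" for t
    have dl: "d \<in> linf" unfolding d_def using x y by simp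
    have "(\<lambda>t. x t + 1 * d t) = (\<lambda>t. y t + (I x - I y))" by (auto simp: d_def)
    then have "I (\<lambda>t. x t + 1 * d t) = I x" using I_transl[OF y] by simp
    with dl have "d \<in> K" by (auto simp: K_def intro!: exI[of _ 1])
    then have "0 \<le> disc_val \<delta> d" by (rule \<delta>)
    also have "disc_val \<delta> d = disc_val \<delta> y - disc_val \<delta> x + (I x - I y)"
      unfolding d_def using x y \<delta>(1) by (simp add: disc_val_add disc_val_diff disc_val_const)
    finally show ?thesis by simp
  qed
  with \<delta>(1) show ?thesis by blast
qed

text \<open>A conjugate of \<open>I\<close> restricted to geometric weights: for \<delta> < 1 it is
  the least cost that keeps the objective above \<open>I\<close> at every bounded sequence.\<close>

definition cost :: "real \<Rightarrow> ereal" where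
  "cost \<delta> = (if \<delta> < 1 then SUP y\<in>linf. ereal (I y - disc_val \<delta> y) else \<infinity>)"

lemma cost_ge: "y \<in> linf \<Longrightarrow> \<delta> < 1 \<Longrightarrow> ereal (I y - disc_val \<delta> y) \<le> cost \<delta>"
  using SUP_upper[of y linf "\<lambda>y. ereal (I y - disc_val \<delta> y)"] by (simp add: cost_def)

lemma cost_nonneg:
  assumes "0 \<le> \<delta>" shows "cost \<delta> \<ge> 0"
proof (cases "\<delta> < 1")
  case True
  then show ?thesis using cost_ge[of "cst 0" \<delta>] assms
    by (simp add: I_cst disc_val_cst zero_ereal_def)
qed (simp add: cost_def)

lemma I_le_obj:
  assumes "x \<in> linf" "\<delta> < 1" shows "ereal (I x) \<le> obj cost \<delta> x"
  using cost_ge[OF assms] unfolding obj_def by (cases "cost \<delta>") (auto simp: algebra_simps)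

text \<open>A supergradient at \<open>x\<close> says that the supremum defining the cost is attained
  at \<open>y = x\<close>.\<close>

lemma obj_attains:
  assumes "x \<in> linf" shows "\<exists>\<delta>\<in>{0..<1}. obj cost \<delta> x = ereal (I x)"
proof -
  obtain \<delta> where \<delta>: "\<delta> \<in> {0..<1}" "\<And>y. y \<in> linf \<Longrightarrow> I y - disc_val \<delta> y \<le> I x - disc_val \<delta> x"
    using supergradient[OF assms] by blast
  have "cost \<delta> \<le> ereal (I x - disc_val \<delta> x)"
    unfolding cost_def using \<delta> by (auto intro!: SUP_least)
  with cost_ge[OF assms, of \<delta>] \<delta>(1) have "cost \<delta> = ereal (I x - disc_val \<delta> x)" by auto
  then have "obj cost \<delta> x = ereal (I x)" by (simp add: obj_def)
  with \<delta>(1) show ?thesis by blast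
qed

text \<open>At the zero sequence the objective is the cost alone, so its minimiser there has cost
  \<open>I (cst 0) = 0\<close>.\<close>

lemma grounded_cost: "grounded cost"
proof -
  obtain \<delta> where \<delta>: "\<delta> \<in> {0..<1}" "obj cost \<delta> (cst 0) = ereal (I (cst 0))"
    using obj_attains[of "cst 0"] by auto
  then have "cost \<delta> = 0" by (simp add: obj_def disc_val_cst I_cst flip: zero_ereal_def)
  show ?thesis unfolding grounded_def
  proof (rule antisym)
    show "(INF \<delta>\<in>{0..1}. cost \<delta>) \<le> 0"
      by (rule INF_lower2[of \<delta>]) (use \<delta>(1) \<open>cost \<delta> = 0\<close> in auto)
    show "0 \<le> (INF \<delta>\<in>{0..1}. cost \<delta>)"
      by (rule INF_greatest) (auto intro: cost_nonneg)
  qed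
qed

text \<open>Below 1 the cost is a supremum of continuous functions. At 1, step sequences of positive
  value whose discounted value tends to an arbitrary \<open>- M\<close> force the cost above
  \<open>M\<close> nearby.\<close>

lemma lsc_cost: "lsc_on {0..1} cost"
  unfolding lsc_on_def
proof (intro ballI allI impI)
  \<comment> \<open>The limit \<open>L\<close> need not be \<open>disc_val \<delta> y\<close>: at
    \<delta> = 1 the latter is 0 because of the factor \<open>1 - \<delta>\<close>.\<close>
  have ev: "\<forall>\<^sub>F \<delta>' in at \<delta> within {0..1}. a < cost \<delta>'"
    if \<delta>: "\<delta> \<in> {0..1}" and y: "y \<in> linf" and lim: "((\<lambda>\<delta>. disc_val \<delta> y) \<longlongrightarrow> L) (at \<delta> within {0..1})"
      and a: "a < ereal (I y - L)" for \<delta> y L and a :: ereal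
  proof -
    have "((\<lambda>\<delta>. ereal (I y - disc_val \<delta> y)) \<longlongrightarrow> ereal (I y - L)) (at \<delta> within {0..1})"
      by (intro tendsto_intros lim)
    then have "\<forall>\<^sub>F \<delta>' in at \<delta> within {0..1}. a < ereal (I y - disc_val \<delta>' y)"
      by (rule order_tendstoD) (rule a)
    then show ?thesis
    proof eventually_elim
      case (elim \<delta>')
      then show ?case using cost_ge[OF y, of \<delta>'] by (cases "\<delta>' < 1") (auto simp: cost_def)
    qed
  qed
  fix \<delta> a assume \<delta>: "\<delta> \<in> {0..1::real}" and a: "a < cost \<delta>"
  show "\<forall>\<^sub>F \<delta>' in at \<delta> within {0..1}. a < cost \<delta>'"
  proof (cases "\<delta> < 1")
    case True
    then obtain y where y: "y \<in> linf" "a < ereal (I y - disc_val \<delta> y)"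
      using a by (auto simp: cost_def less_SUP_iff)
    have "((\<lambda>\<delta>. disc_val \<delta> y) \<longlongrightarrow> disc_val \<delta> y) (at \<delta> within {0..1})"
      using isCont_disc_val[OF y(1), of \<delta>] True \<delta>
      by (auto simp: isCont_def intro: tendsto_within_subset)
    from ev[OF \<delta> y(1) this y(2)] show ?thesis .
  next
    case False
    with \<delta> have [simp]: "\<delta> = 1" by simp
    obtain M where M: "a < ereal M" using ereal_dense2[OF a] by blast
    obtain n where n: "0 < I (\<lambda>t. if t < n then 1 else - M)"
      using I_mono_cont[of "cst 1" 0 "- M", OF linf_cst] I_cst[of 1] by (auto simp: cst_def cong: if_cong)
    define y :: seq where "y t = (if t < n then 1 else - M)" for t
    have yl: "y \<in> linf" unfolding y_def by simp
    have "((\<lambda>\<delta>. 1 + (- M - 1) * \<delta> ^ n) \<longlongrightarrow> 1 + (- M - 1) * 1 ^ n) (at 1 within {0..1})"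
      by (intro tendsto_intros)
    then have "((\<lambda>\<delta>. 1 + (- M - 1) * \<delta> ^ n) \<longlongrightarrow> - M) (at 1 within {0..1})" by simp
    then have lim: "((\<lambda>\<delta>. disc_val \<delta> y) \<longlongrightarrow> - M) (at 1 within {0..1})"
    proof (rule Lim_transform_eventually)
      show "\<forall>\<^sub>F \<delta> in at 1 within {0..1}. 1 + (- M - 1) * \<delta> ^ n = disc_val \<delta> y"
        unfolding y_def by (auto simp: eventually_at disc_val_step intro!: exI[of _ 1])
    qed
    have "a < ereal (I y - (- M))"
      using M n unfolding y_def by (auto elim!: less_trans)
    with ev[OF _ yl lim] show ?thesis by simp
  qed
qed

lemma I_eq_Inf_obj:
  assumes "x \<in> linf" shows "real_of_ereal (INF \<delta>\<in>{0..<1}. obj cost \<delta> x) = I x"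
proof -
  obtain \<delta> where \<delta>: "\<delta> \<in> {0..<1}" "obj cost \<delta> x = ereal (I x)" using obj_attains[OF assms] by blast
  have "(INF \<delta>\<in>{0..<1}. obj cost \<delta> x) = ereal (I x)"
    by (rule antisym) (use \<delta> I_le_obj[OF assms] in \<open>auto intro!: INF_lower2[of \<delta>] INF_greatest\<close>)
  then show ?thesis by simp
qed

end

section \<open>The constant equivalent of a preference\<close>

lemma monotonicityD:
  "monotonicity R \<Longrightarrow> x \<in> linf \<Longrightarrow> y \<in> linf \<Longrightarrow> (\<And>n. y n \<le> x n) \<Longrightarrow> R x y"
  by (simp add: monotonicity_def)

text \<open>If \<open>a\<close> were weakly preferred to some larger \<open>b\<close>, ICRP would
  let the gap be added repeatedly, so 0 would be weakly preferred to every multiple of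
  \<open>b - a\<close>, hence to 1.\<close>

lemma cst_rel_iff:
  assumes wo: "weak_order R" and mon: "monotonicity R" and ic: "ICRP R"
  shows "R (cst a) (cst b) \<longleftrightarrow> b \<le> a"
proof
  assume ab: "R (cst a) (cst b)"
  show "b \<le> a"
  proof (rule ccontr)
    assume "\<not> b \<le> a"
    then have pos: "b - a > 0" by simp
    have tr: "R (cst p) (cst q) \<Longrightarrow> R (cst q) (cst r) \<Longrightarrow> R (cst p) (cst r)" for p q r
      using wo unfolding weak_order_def by (meson linf_cst)
    have sh: "R (cst p) (cst q) \<Longrightarrow> R (cst (p + r)) (cst (q + r))" for p q r
      using ic linf_cst unfolding ICRP_def cst_def by blast
    have step: "R (cst 0) (cst (b - a))" using sh[OF ab, of "- a"] by simp
    have "R (cst 0) (cst (real n * (b - a)))" for n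
    proof (induction n)
      case 0
      then show ?case using mon by (auto simp: monotonicity_def)
    next
      case (Suc n)
      from sh[OF this, of "b - a"] tr[OF step] show ?case by (simp add: algebra_simps)
    qed
    moreover obtain n where "real n * (b - a) \<ge> 1"
      using reals_Archimedean3[OF pos] by (metis less_imp_le)
    then have "R (cst (real n * (b - a))) (cst 1)"
      by (intro monotonicityD[OF mon]) (auto simp: cst_def)
    ultimately have "R (cst 0) (cst 1)" using tr by blast
    with mon show False by (simp add: monotonicity_def strict_def)
  qed
next
  assume "b \<le> a"
  then show "R (cst a) (cst b)" by (intro monotonicityD[OF mon]) (auto simp: cst_def)
qed

text \<open>On the segment of constants from \<open>- B\<close> to \<open>B\<close>, the weakly
  better and the weakly worse points form two closed nonempty sets covering a connected interval, so
  they meet.\<close>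

lemma indiff_cst_exists:
  assumes wo: "weak_order R" and mon: "monotonicity R" and con: "continuity R" and x: "x \<in> linf"
  shows "\<exists>a. R x (cst a) \<and> R (cst a) x"
proof -
  obtain B where B: "\<And>t. \<bar>x t\<bar> \<le> B" using x by (metis linfE)
  have "x n \<le> B" "- B \<le> x n" for n using B[of n] by linarith+
  then have top: "R (cst B) x" and bot: "R x (cst (- B))"
    using monotonicityD[OF mon linf_cst x] monotonicityD[OF mon x linf_cst] by (simp_all add: cst_def)
  have total: "R (cst b) x \<or> R x (cst b)" for b
    using wo x linf_cst unfolding weak_order_def by blast
  define m where "m \<alpha> = \<alpha> * B + (1 - \<alpha>) * (- B)" for \<alpha>
  have "closed {\<alpha>\<in>{0..1}. R (\<lambda>n. \<alpha> * cst B n + (1 - \<alpha>) * cst (- B) n) x} \<and>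
      closed {\<alpha>\<in>{0..1}. R x (\<lambda>n. \<alpha> * cst B n + (1 - \<alpha>) * cst (- B) n)}"
    using con x top bot linf_cst unfolding continuity_def by blast
  then have cl: "closed {\<alpha>\<in>{0..1}. R (cst (m \<alpha>)) x}" "closed {\<alpha>\<in>{0..1}. R x (cst (m \<alpha>))}"
    by (simp_all add: cst_def m_def)
  have "\<exists>\<alpha>. R (cst (m \<alpha>)) x \<and> R x (cst (m \<alpha>))"
  proof (rule ccontr)
    assume "\<not> ?thesis"
    then have disj: "{\<alpha>\<in>{0..1}. R (cst (m \<alpha>)) x} \<inter> {\<alpha>\<in>{0..1}. R x (cst (m \<alpha>))} \<inter> {0..1} = {}"
      by auto
    have cover: "{0..1} \<subseteq> {\<alpha>\<in>{0..1}. R (cst (m \<alpha>)) x} \<union> {\<alpha>\<in>{0..1}. R x (cst (m \<alpha>))}"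
      using total by blast
    have "1 \<in> {\<alpha>\<in>{0..1}. R (cst (m \<alpha>)) x} \<inter> {0..1}" using top by (simp add: m_def)
    moreover have "0 \<in> {\<alpha>\<in>{0..1}. R x (cst (m \<alpha>))} \<inter> {0..1}" using bot by (simp add: m_def)
    ultimately show False
      using connected_closedD[OF connected_Icc disj cover cl] by blast
  qed
  then show ?thesis by blast
qed

lemma constant_equivalent_exists:
  assumes wo: "weak_order R" and mon: "monotonicity R" and con: "continuity R" and ic: "ICRP R"
  shows "\<exists>I. constant_equivalent R I"
proof -
  obtain I where I: "\<And>x. x \<in> linf \<Longrightarrow> R x (cst (I x)) \<and> R (cst (I x)) x"
    using indiff_cst_exists[OF wo mon con] by metis
  have tr: "R p q \<Longrightarrow> R q r \<Longrightarrow> R p r" if "p \<in> linf" "q \<in> linf" "r \<in> linf" for p q r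
    using wo that unfolding weak_order_def by blast
  have "R x y \<longleftrightarrow> I y \<le> I x" if "x \<in> linf" "y \<in> linf" for x y
    using cst_rel_iff[OF wo mon ic, of "I x" "I y"] I[OF that(1)] I[OF that(2)] that
    by (meson linf_cst tr)
  then show ?thesis using I by (auto simp: constant_equivalent_def indiff_def)
qed

lemma discounting_functional_of_axioms:
  assumes ce: "constant_equivalent R I"
    and wo: "weak_order R" and mon: "monotonicity R" and ic: "ICRP R"
    and cx: "convexity R" and mc: "monotone_continuity R" and id: "IDIS R"
  shows "discounting_functional I"
proof
  have R: "R x y \<longleftrightarrow> I y \<le> I x" if "x \<in> linf" "y \<in> linf" for x y
    using ce that by (simp add: constant_equivalent_def)
  have Ix: "R x (cst (I x))" "R (cst (I x)) x" if "x \<in> linf" for x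
    using ce that by (auto simp: constant_equivalent_def indiff_def)
  show I_cst: "I (cst a) = a" for a
    using Ix[of "cst a"] cst_rel_iff[OF wo mon ic] by (auto intro: antisym)
  show "I x \<le> I y" if "x \<in> linf" "y \<in> linf" "\<And>t. x t \<le> y t" for x y
    using mon that R by (auto simp: monotonicity_def)
  show "I (\<lambda>t. x t + a) = I x + a" if x: "x \<in> linf" for x a
  proof (rule antisym)
    have "R (\<lambda>t. x t + a) (\<lambda>t. cst (I x) t + a)" "R (\<lambda>t. cst (I x) t + a) (\<lambda>t. x t + a)"
      using ic Ix[OF x] x linf_cst unfolding ICRP_def by blast+
    moreover have "(\<lambda>t. cst (I x) t + a) = cst (I x + a)" by (simp add: cst_def)
    ultimately have "I (cst (I x + a)) \<le> I (\<lambda>t. x t + a)" "I (\<lambda>t. x t + a) \<le> I (cst (I x + a))"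
      using R x by simp_all
    then show "I (\<lambda>t. x t + a) \<le> I x + a" "I x + a \<le> I (\<lambda>t. x t + a)" by (simp_all add: I_cst)
  qed
  show "\<theta> \<le> I (\<lambda>t. l * x t + (1 - l) * y t)"
    if "x \<in> linf" "y \<in> linf" "\<theta> \<le> I x" "\<theta> \<le> I y" "l \<in> {0..1}" for x y \<theta> l
  proof -
    have "R (\<lambda>t. l * x t + (1 - l) * y t) (cst \<theta>)"
    proof -
      have "R x (cst \<theta>)" "R y (cst \<theta>)" using that R by (simp_all add: I_cst)
      with cx that(1,2,5) show ?thesis unfolding convexity_def by blast
    qed
    then show ?thesis using R that by (simp add: I_cst)
  qed
  show "\<exists>n. \<theta> < I (\<lambda>t. if t < n then x t else k)" if x: "x \<in> linf" and \<theta>: "\<theta> < I x" for x \<theta> k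
  proof -
    have "strict R x (cst \<theta>)" using R x \<theta> by (simp add: strict_def I_cst)
    moreover have "t \<notin> (\<Inter>n. {n..})" for t :: nat
      by (auto intro!: exI[of _ "Suc t"])
    then have "(\<Inter>n. {n::nat..}) = {}" by blast
    moreover have "{Suc n..} \<subseteq> {n..}" for n :: nat by auto
    ultimately obtain n where "strict R (splice (cst k) {n..} x) (cst \<theta>)"
      using mc x unfolding monotone_continuity_def by (metis (no_types, lifting))
    then have "\<theta> < I (splice (cst k) {n..} x)"
      using R[of "splice (cst k) {n..} x" "cst \<theta>"] R[of "cst \<theta>" "splice (cst k) {n..} x"] x
      by (simp add: strict_def I_cst)
    moreover have "splice (cst k) {n..} x = (\<lambda>t. if t < n then x t else k)"
      by (auto simp: splice_def cst_def)
    ultimately show ?thesis by auto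
  qed
  show "I x \<le> I (\<lambda>t. x t + shift0 d t)"
    if "x \<in> linf" "d \<in> linf" "I x \<le> I (\<lambda>t. x t + d t)" for x d
    using id that R[of "\<lambda>t. x t + d t" x] R[of "\<lambda>t. x t + shift0 d t" x] by (simp add: IDIS_def)
qed

section \<open>From the cost function to the axioms\<close>

locale discount_cost =
  fixes c :: "real \<Rightarrow> ereal"
  assumes c_nonneg: "\<delta> \<in> {0..1} \<Longrightarrow> c \<delta> \<ge> 0"
    and c_grounded: "grounded c"
    and c_lsc: "lsc_on {0..1} c"
    and c_1: "c 1 = \<infinity>"
    and c_attained: "x \<in> linf \<Longrightarrow> \<exists>\<delta>\<in>{0..<1}. \<forall>\<delta>'\<in>{0..<1}. obj c \<delta> x \<le> obj c \<delta>' x"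
begin

text \<open>\<open>real_of_ereal\<close> would turn an infinite infimum into 0; attainment together
  with groundedness rules this out.\<close>

definition J :: "seq \<Rightarrow> real" where
  "J x = real_of_ereal (INF \<delta>\<in>{0..<1}. obj c \<delta> x)"

section \<open>Properties of the functional given by a cost\<close>

lemma small_cost:
  assumes "\<epsilon> > 0" obtains \<delta> r where "\<delta> \<in> {0..<1}" "c \<delta> = ereal r" "r < \<epsilon>"
proof -
  have "(INF \<delta>\<in>{0..1}. c \<delta>) < ereal \<epsilon>" using c_grounded assms by (simp add: grounded_def)
  then obtain \<delta> where \<delta>: "\<delta> \<in> {0..1}" "c \<delta> < ereal \<epsilon>" by (auto simp: INF_less_iff)
  then have "\<delta> \<noteq> 1" using c_1 by auto
  with \<delta> c_nonneg[OF \<delta>(1)] show ?thesis by (cases "c \<delta>") (auto intro!: that[of \<delta>])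
qed

lemma J_attained:
  assumes "x \<in> linf"
  obtains \<delta> r where "\<delta> \<in> {0..<1}" "c \<delta> = ereal r" "r \<ge> 0" "J x = disc_val \<delta> x + r"
proof -
  obtain \<delta> where \<delta>: "\<delta> \<in> {0..<1}" "\<And>\<delta>'. \<delta>' \<in> {0..<1} \<Longrightarrow> obj c \<delta> x \<le> obj c \<delta>' x"
    using c_attained[OF assms] by blast
  obtain \<delta>' r' where "\<delta>' \<in> {0..<1}" "c \<delta>' = ereal r'" using small_cost[of 1] by (metis zero_less_one)
  with \<delta>(2)[of \<delta>'] have "c \<delta> \<noteq> \<infinity>" by (auto simp: obj_def)
  with c_nonneg[of \<delta>] \<delta>(1) obtain r where r: "c \<delta> = ereal r" "r \<ge> 0" by (cases "c \<delta>") auto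
  have "(INF \<delta>\<in>{0..<1}. obj c \<delta> x) = obj c \<delta> x"
    by (rule antisym) (use \<delta> in \<open>auto intro!: INF_lower INF_greatest\<close>)
  then have "J x = disc_val \<delta> x + r" by (simp add: J_def obj_def r)
  with \<delta> r that show ?thesis by blast
qed

lemma J_le:
  assumes "x \<in> linf" "\<delta> \<in> {0..<1}" "c \<delta> = ereal r"
  shows "J x \<le> disc_val \<delta> x + r"
proof -
  obtain \<delta>' where \<delta>': "\<delta>' \<in> {0..<1}" "\<And>\<delta>. \<delta> \<in> {0..<1} \<Longrightarrow> obj c \<delta>' x \<le> obj c \<delta> x"
    using c_attained[OF assms(1)] by blast
  have "(INF \<delta>\<in>{0..<1}. obj c \<delta> x) = obj c \<delta>' x"
    by (rule antisym) (use \<delta>' in \<open>auto intro!: INF_lower INF_greatest\<close>)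
  then show ?thesis using \<delta>'(2)[OF assms(2)] c_nonneg[of \<delta>'] \<delta>'(1) assms(3)
    by (cases "c \<delta>'") (auto simp: J_def obj_def)
qed

lemma J_ge:
  assumes "x \<in> linf" "\<And>\<delta> r. \<delta> \<in> {0..<1} \<Longrightarrow> c \<delta> = ereal r \<Longrightarrow> r \<ge> 0 \<Longrightarrow> a \<le> disc_val \<delta> x + r"
  shows "a \<le> J x"
  using J_attained[OF assms(1)] assms(2) by metis

lemma J_mono:
  assumes "x \<in> linf" "y \<in> linf" "\<And>t. x t \<le> y t" shows "J x \<le> J y"
proof (rule J_ge[OF assms(2)])
  fix \<delta> r assume "\<delta> \<in> {0..<1}" "c \<delta> = ereal r"
  then show "J x \<le> disc_val \<delta> y + r"
    using J_le[OF assms(1), of \<delta> r] disc_val_mono[OF assms(1,2) _ _ assms(3), of \<delta>] by auto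
qed

lemma J_cst: "J (cst a) = a"
proof (rule antisym)
  show "J (cst a) \<le> a"
  proof (rule field_le_epsilon)
    fix \<epsilon> :: real assume "\<epsilon> > 0"
    then obtain \<delta> r where "\<delta> \<in> {0..<1}" "c \<delta> = ereal r" "r < \<epsilon>" by (rule small_cost)
    then show "J (cst a) \<le> a + \<epsilon>" using J_le[of "cst a" \<delta> r] by (simp add: disc_val_cst)
  qed
  show "a \<le> J (cst a)" by (rule J_ge) (auto simp: disc_val_cst)
qed

lemma J_transl:
  assumes x: "x \<in> linf" shows "J (\<lambda>t. x t + a) = J x + a"
proof -
  have "J x + b \<le> J (\<lambda>t. x t + b)" if x: "x \<in> linf" for x b
  proof (rule J_ge)
    fix \<delta> r assume "\<delta> \<in> {0..<1}" "c \<delta> = ereal r"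
    then show "J x + b \<le> disc_val \<delta> (\<lambda>t. x t + b) + r"
      using J_le[OF x, of \<delta> r] x by (simp add: disc_val_add disc_val_const)
  qed (use x in simp)
  from this[OF x, of a] this[of "\<lambda>t. x t + a" "- a"] x show ?thesis by simp
qed

text \<open>Each of \<open>x\<close> and \<open>y\<close> lies below the other raised by
  \<open>B\<close>; monotonicity and translation invariance do the rest.\<close>

lemma J_lipschitz:
  assumes "x \<in> linf" "y \<in> linf" "\<And>t. \<bar>x t - y t\<bar> \<le> B" shows "\<bar>J x - J y\<bar> \<le> B"
proof -
  have "J x \<le> J (\<lambda>t. y t + B)" "J y \<le> J (\<lambda>t. x t + B)"
    by (rule J_mono; use assms in \<open>auto simp: abs_le_iff algebra_simps\<close>)+
  then show ?thesis using assms by (simp add: J_transl)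
qed

lemma J_concave:
  assumes "x \<in> linf" "y \<in> linf" "l \<in> {0..1}"
  shows "l * J x + (1 - l) * J y \<le> J (\<lambda>t. l * x t + (1 - l) * y t)"
proof (rule J_ge)
  fix \<delta> r assume \<delta>: "\<delta> \<in> {0..<1}" "c \<delta> = ereal r"
  have "l * J x \<le> l * (disc_val \<delta> x + r)" "(1 - l) * J y \<le> (1 - l) * (disc_val \<delta> y + r)"
    using J_le \<delta> assms by (auto intro!: mult_left_mono)
  moreover have "disc_val \<delta> (\<lambda>t. l * x t + (1 - l) * y t) = l * disc_val \<delta> x + (1 - l) * disc_val \<delta> y"
    using assms \<delta> by (simp add: disc_val_add disc_val_cmult)
  ultimately show "l * J x + (1 - l) * J y \<le> disc_val \<delta> (\<lambda>t. l * x t + (1 - l) * y t) + r"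
    by (simp add: algebra_simps)
qed (use assms in auto)

text \<open>Discounting moves the value of \<open>d\<close> toward 0, so for each \<delta> the
  shifted gain is at least the smaller of 0 and the unshifted gain. Both extremes keep the objective
  at least \<open>J x\<close>.\<close>

lemma J_IDIS:
  assumes x: "x \<in> linf" and d: "d \<in> linf" and le: "J x \<le> J (\<lambda>t. x t + d t)"
  shows "J x \<le> J (\<lambda>t. x t + shift0 d t)"
proof (rule J_ge)
  fix \<delta> r assume \<delta>: "\<delta> \<in> {0..<1}" "c \<delta> = ereal r"
  have 1: "J x \<le> disc_val \<delta> x + r" using J_le[OF x \<delta>] .
  have 2: "J x \<le> disc_val \<delta> x + disc_val \<delta> d + r"
    using J_le[OF linf_add[OF x d] \<delta>] le x d \<delta> by (simp add: disc_val_add)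
  have "min 0 (disc_val \<delta> d) \<le> \<delta> * disc_val \<delta> d"
    using \<delta> mult_right_mono_neg[of \<delta> 1 "disc_val \<delta> d"] by (cases "disc_val \<delta> d \<ge> 0") auto
  with 1 2 have "J x \<le> disc_val \<delta> x + \<delta> * disc_val \<delta> d + r" by linarith
  then show "J x \<le> disc_val \<delta> (\<lambda>t. x t + shift0 d t) + r"
    using x d \<delta> by (simp add: disc_val_add disc_val_shift0)
qed (use x d in auto)

lemma J_continuous:
  assumes "x \<in> linf" "z \<in> linf"
  shows "continuous_on UNIV (\<lambda>\<alpha>. J (\<lambda>t. \<alpha> * x t + (1 - \<alpha>) * z t))"
proof -
  obtain B where B: "B \<ge> 0" "\<And>t. \<bar>x t - z t\<bar> \<le> B"
    using linfE[OF linf_diff[OF assms]] by auto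
  have "B-lipschitz_on UNIV (\<lambda>\<alpha>. J (\<lambda>t. \<alpha> * x t + (1 - \<alpha>) * z t))"
  proof (rule lipschitz_onI)
    fix \<alpha> \<beta> :: real
    have "\<bar>\<alpha> * x t + (1 - \<alpha>) * z t - (\<beta> * x t + (1 - \<beta>) * z t)\<bar> \<le> B * \<bar>\<alpha> - \<beta>\<bar>" for t
    proof -
      have "\<alpha> * x t + (1 - \<alpha>) * z t - (\<beta> * x t + (1 - \<beta>) * z t) = (x t - z t) * (\<alpha> - \<beta>)"
        by (simp add: algebra_simps)
      then show ?thesis using B(2)[of t] by (simp add: abs_mult mult_right_mono)
    qed
    then have "\<bar>J (\<lambda>t. \<alpha> * x t + (1 - \<alpha>) * z t) - J (\<lambda>t. \<beta> * x t + (1 - \<beta>) * z t)\<bar> \<le> B * \<bar>\<alpha> - \<beta>\<bar>"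
      using assms by (intro J_lipschitz) auto
    then show "dist (J (\<lambda>t. \<alpha> * x t + (1 - \<alpha>) * z t)) (J (\<lambda>t. \<beta> * x t + (1 - \<beta>) * z t))
        \<le> B * dist \<alpha> \<beta>" by (simp add: dist_real_def)
  qed (rule B)
  then show ?thesis by (rule lipschitz_on_continuous_on)
qed

text \<open>Consider the minimiser \<delta> for the spliced sequence. Near 1 its cost exceeds
  \<open>\<theta> + B\<close>, by lower semicontinuity and \<open>c 1 = \<infinity>\<close>, which
  outweighs any discounted value. Otherwise \<delta> is at most some \<open>r < 1\<close>, and a
  change confined to dates from \<open>T\<close> on costs at most
  \<open>2 * B * r ^ T\<close>.\<close>

lemma J_monotone_continuity:
  assumes x: "x \<in> linf" and \<theta>: "\<theta> < J x"
    and E: "\<And>n. E (Suc n) \<subseteq> E n" "(\<Inter>n. E n) = {}"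
  shows "\<exists>n. \<theta> < J (splice (cst k) (E n) x)"
proof -
  obtain B0 where B0: "B0 \<ge> 0" "\<And>t. \<bar>x t\<bar> \<le> B0" using x by (metis linfE)
  define B where "B = max B0 \<bar>k\<bar>"
  have B: "B \<ge> 0" "\<And>t. \<bar>x t\<bar> \<le> B" "\<bar>k\<bar> \<le> B"
    using B0 by (auto simp: B_def intro: max.coboundedI1)
  have "\<forall>\<^sub>F \<delta> in at 1 within {0..1}. ereal (\<theta> + B) < c \<delta>"
    using c_lsc c_1 by (simp add: lsc_on_def)
  then obtain \<rho> where \<rho>: "\<rho> > 0" "\<And>\<delta>. \<delta> \<in> {0..1} \<Longrightarrow> \<delta> \<noteq> 1 \<Longrightarrow> dist \<delta> 1 < \<rho> \<Longrightarrow> ereal (\<theta> + B) < c \<delta>"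
    unfolding eventually_at by blast
  define r where "r = max 0 (1 - \<rho>)"
  have r: "0 \<le> r" "r < 1" using \<rho>(1) by (auto simp: r_def)
  have large: "ereal (\<theta> + B) < c \<delta>" if "r < \<delta>" "\<delta> < 1" for \<delta>
    using \<rho>(2)[of \<delta>] that by (auto simp: r_def dist_real_def)
  \<comment> \<open>The denominator \<open>2 * B + 1\<close> is positive even when
    \<open>B = 0\<close>.\<close>
  obtain T where T: "r ^ T < (J x - \<theta>) / (2 * B + 1)"
    using real_arch_pow_inv[of "(J x - \<theta>) / (2 * B + 1)" r] r \<theta> B(1) by auto
  have "2 * B * r ^ T \<le> (2 * B + 1) * r ^ T" using r(1) by (simp add: mult_right_mono)
  also have "\<dots> < J x - \<theta>" using T B(1) by (simp add: field_simps)
  finally have T': "2 * B * r ^ T < J x - \<theta>" .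
  have anti: "E n \<subseteq> E m" if "m \<le> n" for m n
    using lift_Suc_antimono_le[of E, OF E(1) that] .
  \<comment> \<open>Each single date eventually leaves the decreasing sets, hence so do finitely
    many dates at once.\<close>
  have "\<exists>n. \<forall>t<T. t \<notin> E n"
  proof (induction T)
    case (Suc T)
    then obtain n where n: "\<forall>t<T. t \<notin> E n" by blast
    obtain m where m: "T \<notin> E m" using E(2) by blast
    have "\<forall>t<Suc T. t \<notin> E (max m n)"
      using n m anti[of m "max m n"] anti[of n "max m n"] by (auto simp: less_Suc_eq)
    then show ?case by blast
  qed simp
  then obtain n where n: "\<And>t. t < T \<Longrightarrow> t \<notin> E n" by blast
  define z where "z = splice (cst k) (E n) x"
  have zl: "z \<in> linf" using x by (simp add: z_def)
  have z_le: "\<bar>z t\<bar> \<le> B" for t using B by (simp add: z_def splice_def cst_def)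
  obtain \<delta> s where \<delta>: "\<delta> \<in> {0..<1}" "c \<delta> = ereal s" "s \<ge> 0" "J z = disc_val \<delta> z + s"
    using J_attained[OF zl] .
  have "\<theta> < J z"
  proof (cases "r < \<delta>")
    case True
    then have "\<theta> + B < s" using large[of \<delta>] \<delta> by simp
    moreover have "\<bar>disc_val \<delta> z\<bar> \<le> B" using \<delta>(1) z_le by (intro disc_val_le) auto
    ultimately show ?thesis using \<delta>(4) by linarith
  next
    case False
    have "\<bar>disc_val \<delta> (\<lambda>t. x t - z t)\<bar> \<le> 2 * B * \<delta> ^ T"
    proof (rule disc_val_tail_le)
      show "\<bar>x t - z t\<bar> \<le> 2 * B" for t using B(2)[of t] z_le[of t] by linarith
      show "x t - z t = 0" if "t < T" for t using n[OF that] by (simp add: z_def splice_def)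
    qed (use \<delta> in auto)
    also have "\<dots> \<le> 2 * B * r ^ T"
      using False \<delta>(1) B(1) by (intro mult_left_mono power_mono) auto
    finally have "disc_val \<delta> x - disc_val \<delta> z < J x - \<theta>"
      using T' x zl \<delta>(1) by (simp add: disc_val_diff)
    moreover have "J x \<le> disc_val \<delta> x + s" using J_le[OF x \<delta>(1,2)] .
    ultimately show ?thesis using \<delta>(4) by linarith
  qed
  then show ?thesis unfolding z_def by blast
qed

section \<open>The axioms for a represented preference\<close>

lemma axioms_of_representation:
  assumes ce: "constant_equivalent R J"
  shows "weak_order R" "monotonicity R" "continuity R" "ICRP R" "convexity R"
    "monotone_continuity R" "IDIS R"
proof -
  have R: "R x y \<longleftrightarrow> J y \<le> J x" if "x \<in> linf" "y \<in> linf" for x y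
    using ce that by (simp add: constant_equivalent_def)
  show "weak_order R" by (auto simp: weak_order_def R)
  show "monotonicity R" by (auto simp: monotonicity_def strict_def R J_cst intro: J_mono)
  show "ICRP R" by (auto simp: ICRP_def R J_transl)
  show "IDIS R" by (auto simp: IDIS_def R intro: J_IDIS)
  show "monotone_continuity R"
    unfolding monotone_continuity_def
  proof (intro ballI allI impI)
    fix x \<theta> k and E :: "nat \<Rightarrow> nat set"
    assume x: "x \<in> linf" "strict R x (cst \<theta>)" and E: "\<forall>n. E (Suc n) \<subseteq> E n" "(\<Inter>n. E n) = {}"
    have strict: "strict R y (cst \<theta>) \<longleftrightarrow> \<theta> < J y" if "y \<in> linf" for y
      using R[OF that linf_cst] R[OF linf_cst that] by (auto simp: strict_def J_cst)
    obtain n where "\<theta> < J (splice (cst k) (E n) x)"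
      using J_monotone_continuity[of x \<theta> E k] x E strict by blast
    then show "\<exists>n. strict R (splice (cst k) (E n) x) (cst \<theta>)"
      using strict x by auto
  qed
  show "convexity R" unfolding convexity_def
  proof (intro ballI allI impI)
    fix x y \<theta> l assume xy: "x \<in> linf" "y \<in> linf" "R x (cst \<theta>)" "R y (cst \<theta>)" and l: "l \<in> {0..1::real}"
    have "l * \<theta> + (1 - l) * \<theta> \<le> l * J x + (1 - l) * J y"
      using xy l by (intro add_mono mult_left_mono) (auto simp: R J_cst)
    also have "\<dots> \<le> J (\<lambda>t. l * x t + (1 - l) * y t)" using xy l by (intro J_concave)
    finally show "R (\<lambda>t. l * x t + (1 - l) * y t) (cst \<theta>)"
      using xy by (simp add: R J_cst algebra_simps)
  qed
  show "continuity R" unfolding continuity_def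
  proof (intro ballI impI conjI)
    fix x y z assume l: "x \<in> linf" "y \<in> linf" "z \<in> linf"
    have "closed ({0..1} \<inter> {\<alpha>. J y \<le> J (\<lambda>t. \<alpha> * x t + (1 - \<alpha>) * z t)})"
      "closed ({0..1} \<inter> {\<alpha>. J (\<lambda>t. \<alpha> * x t + (1 - \<alpha>) * z t) \<le> J y})"
      using l by (intro closed_Int closed_Collect_le J_continuous continuous_intros closed_atLeastAtMost; simp)+
    moreover have "{\<alpha>\<in>{0..1}. R (\<lambda>t. \<alpha> * x t + (1 - \<alpha>) * z t) y} =
        {0..1} \<inter> {\<alpha>. J y \<le> J (\<lambda>t. \<alpha> * x t + (1 - \<alpha>) * z t)}"
      "{\<alpha>\<in>{0..1}. R y (\<lambda>t. \<alpha> * x t + (1 - \<alpha>) * z t)} =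
        {0..1} \<inter> {\<alpha>. J (\<lambda>t. \<alpha> * x t + (1 - \<alpha>) * z t) \<le> J y}"
      using l by (auto simp: R)
    ultimately show "closed {\<alpha>\<in>{0..1}. R (\<lambda>t. \<alpha> * x t + (1 - \<alpha>) * z t) y}"
      "closed {\<alpha>\<in>{0..1}. R y (\<lambda>t. \<alpha> * x t + (1 - \<alpha>) * z t)}" by simp_all
  qed
qed

end

theorem theorem1:
  fixes R :: "(nat \<Rightarrow> real) \<Rightarrow> (nat \<Rightarrow> real) \<Rightarrow> bool"
  shows "(weak_order R \<and> monotonicity R \<and> continuity R \<and> ICRP R \<and> convexity R \<and>
          monotone_continuity R \<and> IDIS R)
     \<longleftrightarrow>
     (\<exists>c :: real \<Rightarrow> ereal.
        (\<forall>\<delta>\<in>{0..1}. c \<delta> \<ge> 0) \<and> grounded c \<and> lsc_on {0..1} c \<and> c 1 = \<infinity> \<and>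
        (\<forall>x\<in>linf. \<exists>\<delta>\<in>{0..<1}. \<forall>\<delta>'\<in>{0..<1}. obj c \<delta> x \<le> obj c \<delta>' x) \<and>
        constant_equivalent R (\<lambda>x. real_of_ereal (INF \<delta>\<in>{0..<1}. obj c \<delta> x)))"
    (is "?A \<longleftrightarrow> (\<exists>c. ?P c)")
proof
  assume ax: ?A
  then obtain I where I: "constant_equivalent R I" using constant_equivalent_exists by blast
  interpret discounting_functional I
    by (rule discounting_functional_of_axioms[OF I]) (use ax in auto)
  have "\<exists>\<delta>\<in>{0..<1}. \<forall>\<delta>'\<in>{0..<1}. obj cost \<delta> x \<le> obj cost \<delta>' x" if "x \<in> linf" for x
    using obj_attains[OF that] I_le_obj[OF that] by force
  moreover have "constant_equivalent R (\<lambda>x. real_of_ereal (INF \<delta>\<in>{0..<1}. obj cost \<delta> x))"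
    using I by (simp add: constant_equivalent_def I_eq_Inf_obj)
  moreover have "cost 1 = \<infinity>" by (simp add: cost_def)
  ultimately have "?P cost" using cost_nonneg grounded_cost lsc_cost by auto
  then show "\<exists>c. ?P c" by blast
next
  assume "\<exists>c. ?P c"
  then obtain c where c: "?P c" by blast
  interpret discount_cost c by standard (use c in auto)
  have "constant_equivalent R J" using c by (simp add: J_def[abs_def])
  from axioms_of_representation[OF this] show ?A by blast
qed

end
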